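(* Consider the distributed detection system with $N$ sensors under data falsification attacks described in the context, and suppose that the fusion center (FC) follows the Bayesian decision rule, i.e. it uses the threshold $T=T^*$. Then the system using the energy-efficient ordered transmission (EEOT) scheme and the system without ordering have the same detection performance: for each $h\in\{0,1\}$, the probability that the FC decides $\mathcal{H}_1$ given $\mathcal{H}_h$, and the probability that the FC decides $\mathcal{H}_0$ given $\mathcal{H}_h$, are the same for the two systems. In particular the two systems have the same probability of error.
   Context: Model. Hypotheses $\mathcal{H}_0,\mathcal{H}_1$ have prior probabilities $\pi_0,\pi_1>0$, $\pi_0+\pi_1=1$. There are $N\ge 1$ sensors. Conditionally on the hypothesis, the observations $y_1,\dots,y_N$ are i.i.d., with $y_i\sim\mathcal{N}(0,\sigma^2)$ under $\mathcal{H}_0$ and $y_i\sim\mathcal{N}(s,\sigma^2)$ under $\mathcal{H}_1$, where $s>0$ and $\sigma>0$. Sensor $i$ computes the log-likelihood ratio $L_i=\log\big(f(y_i|\mathcal{H}_1)/f(y_i|\mathcal{H}_0)\big)$ and the local decision $v_i=1$ if $L_i>\lambda$, $v_i=0$ otherwise, with $\lambda=\log(\pi_0/\pi_1)$. Attack. Each sensor is independently malicious with probability $\alpha<1/2$. A malicious sensor flips its decision with probability $p\in[0,1]$; honest sensors do not flip. Thus, independently over sensors and independently of the observations, the decision $u_i$ sent to the FC is $u_i=1-v_i$ with probability $\alpha p$ and $u_i=v_i$ with probability $1-\alpha p$. Write $\widetilde{\pi}_{1,h}=\Pr(u_i=1|\mathcal{H}_h)$ for $h=0,1$. Unordered system.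 The FC receives all $u_i$ and decides $\mathcal{H}_1$ if $Z=\sum_{i=1}^N u_i\ge T$ and $\mathcal{H}_0$ if $Z<T$. EEOT system. Sensors transmit in decreasing order of $|L_i|$: with $|L_{[1]}|>|L_{[2]}|>\dots>|L_{[N]}|$ (almost surely there are no ties), the FC receives $u_{[1]},u_{[2]},\dots$ in this order. At the first $k\in\{1,\dots,N\}$ for which one of the following holds, the FC stops and decides: it decides $\mathcal{H}_1$ if $\sum_{i=1}^k u_{[i]}\ge T$, and $\mathcal{H}_0$ if $\sum_{i=1}^k u_{[i]}<T-(N-k)$. Bayesian decision rule. The Bayesian (likelihood-ratio) rule $\prod_i P(u_i|\mathcal{H}_1)/\prod_i P(u_i|\mathcal{H}_0)\gtrless \pi_0/\pi_1$ is the comparison of $Z$ with the threshold $$T^*=\frac{\log\left(\frac{\pi_0}{\pi_1}\right)+N\log\left(\frac{1-\widetilde{\pi}_{1,0}}{1-\widetilde{\pi}_{1,1}}\right)}{\log\left(\frac{\widetilde{\pi}_{1,1}(1-\widetilde{\pi}_{1,0})}{\widetilde{\pi}_{1,0}(1-\widetilde{\pi}_{1,1})}\right)}.$$ The probability of error is $\pi_0\Pr(\text{decide }\mathcal{H}_1|\mathcal{H}_0)+\pi_1\Pr(\text{decide }\mathcal{H}_0|\mathcal{H}_1)$. *)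

theory Defs
  imports "HOL-Probability.Probability"
begin

datatype hypothesis = H0 | H1

definition signal_mean :: "real \<Rightarrow> hypothesis \<Rightarrow> real" where
  "signal_mean s h = (case h of H0 \<Rightarrow> 0 | H1 \<Rightarrow> s)"

definition obs_density :: "real \<Rightarrow> real \<Rightarrow> hypothesis \<Rightarrow> real \<Rightarrow> real" where
  "obs_density s \<sigma> h = normal_density (signal_mean s h) \<sigma>"

definition llr :: "real \<Rightarrow> real \<Rightarrow> real \<Rightarrow> real" where
  "llr s \<sigma> x = ln (obs_density s \<sigma> H1 x / obs_density s \<sigma> H0 x)"

definition local_decision :: "real \<Rightarrow> real \<Rightarrow> real \<Rightarrow> real \<Rightarrow> real \<Rightarrow> nat" where
  "local_decision s \<sigma> \<pi>0 \<pi>1 x = (if llr s \<sigma> x > ln (\<pi>0 / \<pi>1) then 1 else 0)"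

definition sent_decision :: "real \<Rightarrow> real \<Rightarrow> real \<Rightarrow> real \<Rightarrow> real \<Rightarrow> bool \<Rightarrow> nat" where
  "sent_decision s \<sigma> \<pi>0 \<pi>1 x flipped =
     (if flipped then 1 - local_decision s \<sigma> \<pi>0 \<pi>1 x else local_decision s \<sigma> \<pi>0 \<pi>1 x)"

text \<open>Sensors are numbered \<open>0, \<dots>, N - 1\<close>. The conditional law given hypothesis \<open>h\<close> is the
  normalised restriction of \<open>M\<close> to the event \<open>Hyp = h\<close>. Given \<open>h\<close>, the last two assumptions
  say that the vectors \<open>(y i, mal i, flip i)\<close> are mutually independent over \<open>i\<close> and that
  \<open>(mal i, flip i)\<close> is independent of \<open>y i\<close> for each \<open>i\<close>. Flipping with probability \<open>p\<close> when
  malicious is stated through the joint probability \<open>\<alpha> * p\<close>, which also covers \<open>\<alpha> = 0\<close>.\<close>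

locale sensor_network = prob_space M
  for M :: "'a measure" +
  fixes Hyp :: "'a \<Rightarrow> hypothesis"
    and y :: "nat \<Rightarrow> 'a \<Rightarrow> real"
    and mal flip :: "nat \<Rightarrow> 'a \<Rightarrow> bool"
    and N :: nat
    and s \<sigma> \<pi>0 \<pi>1 \<alpha> p :: real
  assumes N_pos: "N \<ge> 1"
    and s_pos: "s > 0"
    and sigma_pos: "\<sigma> > 0"
    and prior_pos: "\<pi>0 > 0" "\<pi>1 > 0"
    and prior_sum: "\<pi>0 + \<pi>1 = 1"
    and alpha_range: "0 \<le> \<alpha>" "\<alpha> < 1 / 2"
    and p_range: "0 \<le> p" "p \<le> 1"
    and Hyp_measurable [measurable]: "Hyp \<in> measurable M (count_space UNIV)"
    and y_measurable [measurable]: "\<And>i. i < N \<Longrightarrow> y i \<in> borel_measurable M"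
    and mal_measurable [measurable]: "\<And>i. i < N \<Longrightarrow> mal i \<in> measurable M (count_space UNIV)"
    and flip_measurable [measurable]: "\<And>i. i < N \<Longrightarrow> flip i \<in> measurable M (count_space UNIV)"
    and prior: "\<P>(\<omega> in M. Hyp \<omega> = H0) = \<pi>0" "\<P>(\<omega> in M. Hyp \<omega> = H1) = \<pi>1"
    and obs_distr: "\<And>h i. i < N \<Longrightarrow>
      distributed (uniform_measure M {\<omega> \<in> space M. Hyp \<omega> = h}) lborel (y i)
        (\<lambda>x. ennreal (obs_density s \<sigma> h x))"
    and malicious: "\<And>h i. i < N \<Longrightarrow> \<P>(\<omega> in M. mal i \<omega> \<bar> Hyp \<omega> = h) = \<alpha>"
    and malicious_flip:
      "\<And>h i. i < N \<Longrightarrow> \<P>(\<omega> in M. mal i \<omega> \<and> flip i \<omega> \<bar> Hyp \<omega> = h) = \<alpha> * p"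
    and honest_no_flip:
      "\<And>h i. i < N \<Longrightarrow> \<P>(\<omega> in M. \<not> mal i \<omega> \<and> flip i \<omega> \<bar> Hyp \<omega> = h) = 0"
    and indep_sensors: "\<And>h. prob_space.indep_vars (uniform_measure M {\<omega> \<in> space M. Hyp \<omega> = h})
      (\<lambda>i. borel \<Otimes>\<^sub>M count_space UNIV) (\<lambda>i \<omega>. (y i \<omega>, (mal i \<omega>, flip i \<omega>))) {..<N}"
    and indep_attack: "\<And>h i A B. i < N \<Longrightarrow> A \<in> sets borel \<Longrightarrow>
      \<P>(\<omega> in M. y i \<omega> \<in> A \<and> (mal i \<omega>, flip i \<omega>) \<in> B \<bar> Hyp \<omega> = h) =
      \<P>(\<omega> in M. y i \<omega> \<in> A \<bar> Hyp \<omega> = h) * \<P>(\<omega> in M. (mal i \<omega>, flip i \<omega>) \<in> B \<bar> Hyp \<omega> = h)"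

text \<open>In the following, \<open>T\<close> is the threshold and \<open>u i\<close> is the bit sent by sensor \<open>i\<close>.\<close>

definition unordered_decides :: "nat \<Rightarrow> real \<Rightarrow> (nat \<Rightarrow> nat) \<Rightarrow> hypothesis \<Rightarrow> bool" where
  "unordered_decides N T u d =
     (case d of H0 \<Rightarrow> real (\<Sum>i<N. u i) < T | H1 \<Rightarrow> real (\<Sum>i<N. u i) \<ge> T)"

text \<open>Sensors in decreasing order of the magnitude of their log-likelihood ratio \<open>L i\<close>. The sort is
  stable, so ties (which have probability 0) are broken by the smaller index.\<close>

definition transmission_order :: "nat \<Rightarrow> (nat \<Rightarrow> real) \<Rightarrow> nat list" where
  "transmission_order N L = sort_key (\<lambda>i. - \<bar>L i\<bar>) [0..<N]"

definition ordered_sum :: "nat \<Rightarrow> (nat \<Rightarrow> real) \<Rightarrow> (nat \<Rightarrow> nat) \<Rightarrow> nat \<Rightarrow> real" where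
  "ordered_sum N L u k = real (\<Sum>j<k. u (transmission_order N L ! j))"

definition eeot_condition ::
  "nat \<Rightarrow> real \<Rightarrow> (nat \<Rightarrow> real) \<Rightarrow> (nat \<Rightarrow> nat) \<Rightarrow> nat \<Rightarrow> hypothesis \<Rightarrow> bool" where
  "eeot_condition N T L u k d =
     (case d of H0 \<Rightarrow> ordered_sum N L u k < T - (real N - real k)
              | H1 \<Rightarrow> ordered_sum N L u k \<ge> T)"

definition eeot_decides ::
  "nat \<Rightarrow> real \<Rightarrow> (nat \<Rightarrow> real) \<Rightarrow> (nat \<Rightarrow> nat) \<Rightarrow> hypothesis \<Rightarrow> bool" where
  "eeot_decides N T L u d =
     (\<exists>k\<in>{1..N}. (\<forall>j\<in>{1..<k}. \<forall>d'. \<not> eeot_condition N T L u j d') \<and> eeot_condition N T L u k d)"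

definition bayes_threshold :: "nat \<Rightarrow> real \<Rightarrow> real \<Rightarrow> real \<Rightarrow> real \<Rightarrow> real" where
  "bayes_threshold N \<pi>0 \<pi>1 q0 q1 =
     (ln (\<pi>0 / \<pi>1) + real N * ln ((1 - q0) / (1 - q1))) / ln (q1 * (1 - q0) / (q0 * (1 - q1)))"

text \<open>\<open>D \<omega> d\<close> means that the fusion center decides \<open>d\<close> at outcome \<open>\<omega>\<close>.\<close>

definition decision_prob ::
  "'a measure \<Rightarrow> ('a \<Rightarrow> hypothesis) \<Rightarrow> ('a \<Rightarrow> hypothesis \<Rightarrow> bool) \<Rightarrow> hypothesis \<Rightarrow> hypothesis \<Rightarrow> real" where
  "decision_prob M Hyp D d h = \<P>(\<omega> in M. D \<omega> d \<bar> Hyp \<omega> = h)"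

definition error_prob ::
  "real \<Rightarrow> real \<Rightarrow> 'a measure \<Rightarrow> ('a \<Rightarrow> hypothesis) \<Rightarrow> ('a \<Rightarrow> hypothesis \<Rightarrow> bool) \<Rightarrow> real" where
  "error_prob \<pi>0 \<pi>1 M Hyp D = \<pi>0 * decision_prob M Hyp D H1 H0 + \<pi>1 * decision_prob M Hyp D H0 H1"

end

(* The two systems agree at every outcome and for every threshold: since each sent bit is at most 1,
   both stopping conditions already determine the comparison of the full sum with the threshold,
   and at k = N one of them holds. *)

theory Submission
  imports Defs
begin

lemma sent_decision_le_1: "sent_decision s \<sigma> \<pi>0 \<pi>1 x b \<le> 1"
  by (simp add: sent_decision_def local_decision_def)

text \<open>Sorting only permutes the sensors: the sorted list is distinct and has the same set of
  entries as \<open>[0..<N]\<close>.\<close>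

lemma sum_transmission_order: "(\<Sum>j<N. f (transmission_order N L ! j)) = (\<Sum>i<N. f i)"
proof -
  have "(\<Sum>j<N. f (transmission_order N L ! j)) = sum_list (map f (transmission_order N L))"
    by (simp add: sum_list_sum_nth atLeast0LessThan transmission_order_def)
  also have "\<dots> = sum f (set (transmission_order N L))"
    by (simp add: sum_list_distinct_conv_sum_set transmission_order_def)
  finally show ?thesis
    by (simp add: transmission_order_def atLeast0LessThan)
qed

text \<open>The bits still missing after \<open>k\<close> transmissions are natural numbers, so they
  cannot lower the count. A count that has reached \<open>T\<close> stays there.\<close>

lemma ordered_sum_le_sum:
  assumes "k \<le> N"
  shows "ordered_sum N L u k \<le> real (\<Sum>i<N. u i)"
proof -
  have "(\<Sum>j<k. u (transmission_order N L ! j)) \<le> (\<Sum>j<N. u (transmission_order N L ! j))"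
    using assms by (intro sum_mono2) auto
  then show ?thesis
    unfolding ordered_sum_def sum_transmission_order by linarith
qed

text \<open>Each of the \<open>N - k\<close> missing bits adds at most 1. This is the slack that the
  stopping condition for \<open>H0\<close> subtracts from \<open>T\<close>.\<close>

lemma sum_le_ordered_sum:
  assumes "k \<le> N" and "\<And>i. u i \<le> 1"
  shows "real (\<Sum>i<N. u i) \<le> ordered_sum N L u k + (real N - real k)"
proof -
  let ?g = "\<lambda>j. u (transmission_order N L ! j)"
  have "sum ?g {k..<N} \<le> N - k"
    using sum_bounded_above[of "{k..<N}" ?g 1] assms(2) by simp
  moreover have "sum ?g {..<N} = sum ?g {..<k} + sum ?g {k..<N}"
    using sum.atLeastLessThan_concat[of 0 k N ?g] assms(1) by (simp add: atLeast0LessThan)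
  ultimately have "(\<Sum>i<N. u i) \<le> sum ?g {..<k} + (N - k)"
    by (simp add: sum_transmission_order)
  then show ?thesis
    unfolding ordered_sum_def using assms(1) by linarith
qed

text \<open>Stopping early is safe: for \<open>H1\<close> by the lower bound on the full sum, for
  \<open>H0\<close> by the upper bound.\<close>

lemma eeot_condition_imp_unordered_decides:
  assumes "k \<le> N" and "\<And>i. u i \<le> 1" and "eeot_condition N T L u k d"
  shows "unordered_decides N T u d"
  using ordered_sum_le_sum[of k N L u] sum_le_ordered_sum[of k N u L] assms
  by (cases d) (auto simp: eeot_condition_def unordered_decides_def)

text \<open>At \<open>k = N\<close> the slack \<open>N - k\<close> vanishes and the partial sum is
  the full sum. This guarantees that the ordered scheme stops.\<close>

lemma eeot_condition_all_received:
  "eeot_condition N T L u N d \<longleftrightarrow> unordered_decides N T u d"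
  by (simp add: eeot_condition_def unordered_decides_def ordered_sum_def sum_transmission_order
      split: hypothesis.split)

lemma unordered_decides_unique:
  assumes "unordered_decides N T u d" and "unordered_decides N T u d'"
  shows "d = d'"
  using assms by (cases d; cases d') (auto simp: unordered_decides_def)

lemma eeot_decides_iff_unordered_decides:
  assumes "N \<ge> 1" and u: "\<And>i. u i \<le> 1"
  shows "eeot_decides N T L u d \<longleftrightarrow> unordered_decides N T u d"
proof
  assume "eeot_decides N T L u d"
  then show "unordered_decides N T u d"
    using eeot_condition_imp_unordered_decides[where u = u, OF _ u] by (auto simp: eeot_decides_def)
next
  assume d: "unordered_decides N T u d"
  \<comment> \<open>The bound \<open>k \<ge> 1\<close> keeps \<open>LEAST\<close> from choosing the
    empty stage 0, which meets the \<open>H1\<close> condition if \<open>T \<le> 0\<close> but is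
    never tested by the scheme.\<close>
  let ?stops = "\<lambda>k. k \<ge> 1 \<and> (\<exists>d'. eeot_condition N T L u k d')"
  define k where "k = (LEAST k. ?stops k)"
  have N: "?stops N"
    using d assms(1) by (auto simp: eeot_condition_all_received)
  have k: "?stops k"
    unfolding k_def using N by (rule LeastI)
  have "k \<le> N"
    unfolding k_def using N by (rule Least_le)
  obtain d' where d': "eeot_condition N T L u k d'"
    using k by blast
  \<comment> \<open>The first stop could a priori favour another hypothesis than \<open>d\<close>;
    but the unordered rule also decides \<open>d'\<close>, and its decision is unique.\<close>
  have "d' = d"
    using eeot_condition_imp_unordered_decides[where u = u, OF \<open>k \<le> N\<close> u d'] d
    by (rule unordered_decides_unique)
  moreover have "\<not> eeot_condition N T L u j e" if "j \<in> {1..<k}" for j e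
    using that not_less_Least[of j ?stops] by (auto simp: k_def)
  ultimately show "eeot_decides N T L u d"
    unfolding eeot_decides_def using k \<open>k \<le> N\<close> d' by (intro bexI[of _ k]) auto
qed

theorem mainTheorem1:
  fixes M :: "'a measure"
    and Hyp :: "'a \<Rightarrow> hypothesis"
    and y :: "nat \<Rightarrow> 'a \<Rightarrow> real"
    and mal flip :: "nat \<Rightarrow> 'a \<Rightarrow> bool"
    and N i :: nat
    and s \<sigma> \<pi>0 \<pi>1 \<alpha> p T :: real
    and u :: "nat \<Rightarrow> 'a \<Rightarrow> nat"
    and q :: "hypothesis \<Rightarrow> real"
    and unordered eeot :: "'a \<Rightarrow> hypothesis \<Rightarrow> bool"
  assumes network: "sensor_network M Hyp y mal flip N s \<sigma> \<pi>0 \<pi>1 \<alpha> p"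
    and u: "u = (\<lambda>j \<omega>. sent_decision s \<sigma> \<pi>0 \<pi>1 (y j \<omega>) (flip j \<omega>))"
    and i: "i < N"
    and q: "q = (\<lambda>h. \<P>(\<omega> in M. u i \<omega> = 1 \<bar> Hyp \<omega> = h))"
    and T: "T = bayes_threshold N \<pi>0 \<pi>1 (q H0) (q H1)"
    and unordered: "unordered = (\<lambda>\<omega>. unordered_decides N T (\<lambda>j. u j \<omega>))"
    and eeot: "eeot = (\<lambda>\<omega>. eeot_decides N T (\<lambda>j. llr s \<sigma> (y j \<omega>)) (\<lambda>j. u j \<omega>))"
  shows "(\<forall>h. decision_prob M Hyp eeot H1 h = decision_prob M Hyp unordered H1 h \<and>
              decision_prob M Hyp eeot H0 h = decision_prob M Hyp unordered H0 h) \<and>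
         error_prob \<pi>0 \<pi>1 M Hyp eeot = error_prob \<pi>0 \<pi>1 M Hyp unordered"
proof -
  interpret sensor_network M Hyp y mal flip N s \<sigma> \<pi>0 \<pi>1 \<alpha> p
    by (rule network)
  \<comment> \<open>Equality as functions of the outcome makes all conditional probabilities, and
    hence the error probabilities, coincide.\<close>
  have "eeot = unordered"
    unfolding eeot unordered u
    by (intro ext eeot_decides_iff_unordered_decides N_pos sent_decision_le_1)
  then show ?thesis
    by simp
qed

end
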